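(* For every integer $n \geq 0$, $$\sum_{m=0}^n 2^{-m} E_m S_1(n,m) = Ch_{n,\frac{1}{2}}.$$
   Context: The Euler numbers $E_n$ are defined by the generating function $\frac{2}{e^t+1} = \sum_{n\ge 0} E_n \frac{t^n}{n!}$. The Stirling numbers of the first kind $S_1(n,l)$ are defined by $(x)_n = x(x-1)\cdots(x-n+1) = \sum_{l=0}^n S_1(n,l)x^l$. The $\frac12$-Changhee numbers $Ch_{n,\frac12}$ are defined by the formal power series identity $\frac{2}{1+\sqrt{1+t}} = \sum_{n\ge 0} Ch_{n,\frac12}\frac{t^n}{n!}$, where $\sqrt{1+t} = (1+t)^{1/2} = \sum_{n\ge0}\binom{1/2}{n}t^n$. *)

theory Defs
  imports Complex_Main "HOL-Computational_Algebra.Computational_Algebra"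
begin

text \<open>Division is that of formal power series over a field; both denominators below have constant
  coefficient 2, so it is multiplication by the inverse series.\<close>

definition euler_number :: "nat \<Rightarrow> real" where
  "euler_number n = fact n * fps_nth (2 / (fps_exp 1 + 1)) n"

definition half_changhee :: "nat \<Rightarrow> real" where
  "half_changhee n = fact n * fps_nth (2 / (1 + fps_binomial (1 / 2))) n"

text \<open>The Stirling numbers of the first kind are signed here, whereas
  \<open>stirling\<close> of HOL-Combinatorics is their absolute value.\<close>

definition falling_factorial_poly :: "nat \<Rightarrow> int poly" where
  "falling_factorial_poly n = (\<Prod>i<n. [:- int i, 1:])"

definition stirling1 :: "nat \<Rightarrow> nat \<Rightarrow> int" where
  "stirling1 n l = coeff (falling_factorial_poly n) l"

lemma euler_number_gf:
  "2 / (fps_exp 1 + 1) = Abs_fps (\<lambda>n. euler_number n / fact n)"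
  by (rule fps_ext) (simp add: euler_number_def)

lemma half_changhee_gf:
  "2 / (1 + fps_binomial (1 / 2)) = Abs_fps (\<lambda>n. half_changhee n / fact n)"
  by (rule fps_ext) (simp add: half_changhee_def)

lemma fps_binomial_half_square: "fps_binomial (1 / 2 :: real) ^ 2 = 1 + fps_X"
  by (simp add: fps_binomial_power fps_binomial_1)

lemma degree_falling_factorial_poly: "degree (falling_factorial_poly n) = n"
  by (simp add: falling_factorial_poly_def degree_prod_eq_sum_degree)

lemma falling_factorial_stirling1:
  "(\<Prod>i<n. x - int i) = (\<Sum>l\<le>n. stirling1 n l * x ^ l)"
proof -
  have "(\<Prod>i<n. x - int i) = poly (falling_factorial_poly n) x"
    by (simp add: falling_factorial_poly_def poly_prod)
  then show ?thesis
    by (simp add: poly_altdef degree_falling_factorial_poly stirling1_def)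
qed

end

theory Submission
  imports Defs
begin

text \<open>Substituting \<open>t = ln (1 + u) / 2\<close> into \<open>2 / (e\<^sup>t + 1)\<close> gives
  \<open>2 / (1 + sqrt (1 + u))\<close>, and the powers \<open>(ln (1 + u))\<^sup>m / m!\<close> are the exponential
  generating functions of the Stirling numbers \<open>S\<^sub>1(n, m)\<close>.\<close>

text \<open>Both sides solve F' = c F / (1 + X) with constant coefficient 1, and this determines the
  series.\<close>

lemma fps_exp_compose_fps_ln:
  "fps_exp c oo fps_ln 1 = (fps_binomial c :: 'a :: field_char_0 fps)"
proof -
  have "fps_deriv (fps_exp c oo fps_ln 1) =
      fps_const c * (fps_exp c oo fps_ln 1) * inverse (1 + fps_X)"
    by (simp add: fps_compose_deriv fps_ln_deriv fps_compose_mult_distrib)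
  then show ?thesis
    by (subst fps_binomial_ODE_unique' [symmetric]) (simp add: fps_divide_unit)
qed

lemma map_poly_of_int_mult:
  "map_poly of_int (p * q) = (map_poly of_int p * map_poly of_int q :: 'a :: comm_ring_1 poly)"
  by (rule poly_eqI) (simp add: coeff_map_poly coeff_mult)

text \<open>Comparing coefficients below needs x to range over a field, whereas
  \<open>falling_factorial_stirling1\<close> covers integer x only; hence the integer polynomial is
  mapped into the field.\<close>

lemma sum_stirling1_eq_gbinomial:
  "(\<Sum>l\<le>n. of_int (stirling1 n l) * x ^ l) = fact n * ((x :: 'a :: field_char_0) gchoose n)"
proof -
  have "fact n * (x gchoose n) = (\<Prod>i<n. x - of_nat i)"
    by (simp add: gbinomial_prod_rev atLeast0LessThan)
  also have "\<dots> = poly (map_poly of_int (falling_factorial_poly n)) x"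
  proof -
    have "map_poly of_int (falling_factorial_poly n) = (\<Prod>i<n. [:- of_nat i, 1:] :: 'a poly)"
      unfolding falling_factorial_poly_def
      by (induction n) (simp_all add: map_poly_of_int_mult map_poly_pCons del: mult_pCons_right)
    then show ?thesis
      by (simp add: poly_prod)
  qed
  also have "\<dots> = (\<Sum>l\<le>n. of_int (stirling1 n l) * x ^ l)"
    by (simp add: poly_altdef degree_map_poly coeff_map_poly degree_falling_factorial_poly stirling1_def)
  finally show ?thesis ..
qed

text \<open>Both sides are the coefficients, as a polynomial in \<open>x\<close>, of the coefficient of \<open>u\<^sup>n\<close> in
  \<open>(1 + u)\<^sup>x = exp (x ln (1 + u))\<close>.\<close>

lemma fps_ln_power_nth:
  assumes "m \<le> n"
  shows "fps_ln 1 ^ m $ n = (fact m / fact n * of_int (stirling1 n m) :: 'a :: real_normed_field)"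
proof -
  have "(\<Sum>l\<le>n. (fps_ln 1 ^ l $ n / fact l) * x ^ l) =
      (\<Sum>l\<le>n. (of_int (stirling1 n l) / fact n) * x ^ l)" for x :: 'a
  proof -
    have "(\<Sum>l\<le>n. (fps_ln 1 ^ l $ n / fact l) * x ^ l) = (fps_exp x oo fps_ln 1) $ n"
      by (simp add: fps_compose_nth atLeast0AtMost mult_ac)
    also have "\<dots> = x gchoose n"
      by (simp add: fps_exp_compose_fps_ln)
    also have "\<dots> = (\<Sum>l\<le>n. of_int (stirling1 n l) * x ^ l) / fact n"
      by (simp add: sum_stirling1_eq_gbinomial)
    finally show ?thesis
      by (simp add: sum_divide_distrib)
  qed
  \<comment> \<open>The two polynomial functions agree at every x, so their coefficients
    agree.\<close>
  then have "fps_ln 1 ^ m $ n / fact m = (of_int (stirling1 n m) / fact n :: 'a)"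
    using assms polyfun_eq_coeffs [where c = "\<lambda>l. fps_ln 1 ^ l $ n / fact l :: 'a"
        and d = "\<lambda>l. of_int (stirling1 n l) / fact n"]
    by blast
  then show ?thesis
    by (simp add: field_simps)
qed

text \<open>Both inner series have constant coefficient 0 and the denominators do not, so
  composition passes through the quotients. Halving is kept as a separate composition because it
  just scales coefficient m by (1/2)^m.\<close>

lemma fps_euler_compose:
  "(2 / (fps_exp 1 + 1)) oo (fps_const (1 / 2) * fps_X) oo fps_ln 1 =
    2 / (1 + fps_binomial (1 / 2) :: real fps)"
proof -
  have two: "(2 :: real fps) oo g = 2" for g
    by (metis fps_const_compose numeral_fps_const)
  have "(2 / (fps_exp 1 + 1)) oo (fps_const (1 / 2) * fps_X) =
      2 / (fps_exp (1 / 2) + 1 :: real fps)"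
    by (subst fps_divide_compose) (simp_all add: two fps_compose_add_distrib)
  moreover have "(2 / (fps_exp (1 / 2) + 1)) oo fps_ln 1 =
      2 / (fps_binomial (1 / 2) + 1 :: real fps)"
    by (subst fps_divide_compose)
      (simp_all add: two fps_compose_add_distrib fps_exp_compose_fps_ln)
  ultimately show ?thesis
    by (simp add: add.commute)
qed

theorem theorem1:
  fixes n :: nat
  shows "(\<Sum>m = 0..n. (1 / 2 ^ m) * euler_number m * of_int (stirling1 n m)) = half_changhee n"
proof -
  have "half_changhee n =
      fact n * ((2 / (fps_exp 1 + 1)) oo (fps_const (1 / 2) * fps_X) oo fps_ln 1) $ n"
    by (simp add: half_changhee_def fps_euler_compose)
  also have "\<dots> = fact n * (\<Sum>m = 0..n. (1 / 2) ^ m * (2 / (fps_exp 1 + 1)) $ m * fps_ln 1 ^ m $ n)"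
    by (simp add: fps_compose_nth [of _ "fps_ln 1"] fps_compose_linear)
  \<comment> \<open>The factor \<open>fact m / fact n\<close> from \<open>fps_ln_power_nth\<close>
    absorbs the leading \<open>fact n\<close> and turns the m-th coefficient into
    \<open>euler_number m\<close>.\<close>
  also have "\<dots> = (\<Sum>m = 0..n. (1 / 2 ^ m) * euler_number m * of_int (stirling1 n m))"
    unfolding sum_distrib_left
    by (intro sum.cong refl) (simp add: fps_ln_power_nth euler_number_def power_one_over field_simps)
  finally show ?thesis ..
qed

end
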